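(* Let $\mathbf A=(a_{ij})\in\mathcal A$ be a pairwise comparison matrix of order $n$, and let $\mathbf S=\mathbf D_1\mathbf A\mathbf D_2$ be its Sinkhorn scaling, with $\mathbf D_1=\operatorname{diag}(d^{(1)}_1,\ldots,d^{(1)}_n)$ and $\mathbf D_2=\operatorname{diag}(d^{(2)}_1,\ldots,d^{(2)}_n)$. Then the following conditions are equivalent: (1) $\mathbf A\in\mathcal A^*$, i.e. $\mathbf A$ is consistent; (2) $\mathbf S=\frac1n\mathbf 1\mathbf 1^\top$, where $\mathbf 1=(1,\ldots,1)^\top\in\mathbb R^n$; (3) the vector $(d^{(2)}_1,\ldots,d^{(2)}_n)$ is compatible with $\mathbf A$, that is, $a_{ij}=d^{(2)}_i/d^{(2)}_j$ for all $i,j$; (4) the componentwise inverse of $(d^{(1)}_1,\ldots,d^{(1)}_n)$ is compatible with $\mathbf A$, that is, $a_{ij}=d^{(1)}_j/d^{(1)}_i$ for all $i,j$.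
   Context: $\mathcal A$ is the set of pairwise comparison matrices: real $n\times n$ matrices $\mathbf A=(a_{ij})$ with positive entries such that $a_{ii}=1$ for all $i$ and $a_{ij}=1/a_{ji}$ for all $i,j$. $\mathbf A\in\mathcal A$ is consistent if there is a vector $\mathbf w=(w_1,\ldots,w_n)^\top$ with positive components such that $a_{ij}=w_i/w_j$ for all $i,j$; such a vector is called compatible with $\mathbf A$. $\mathcal A^*\subset\mathcal A$ is the set of consistent matrices. Sinkhorn scaling: by Sinkhorn's theorem, for every $n\times n$ matrix $\mathbf A$ with positive entries there exist diagonal matrices $\mathbf D_1,\mathbf D_2$ with strictly positive diagonal entries such that $\mathbf S=\mathbf D_1\mathbf A\mathbf D_2$ is doubly stochastic (nonnegative entries, all row and column sums equal to $1$). The matrix $\mathbf S$ is unique, and the pair $(\mathbf D_1,\mathbf D_2)$ is unique up to replacement by $(c\mathbf D_1,c^{-1}\mathbf D_2)$ with $c>0$. The factorization $\mathbf S=\mathbf D_1\mathbf A\mathbf D_2$ is called the Sinkhorn scaling of $\mathbf A$. *)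

theory Defs
  imports "HOL-Analysis.Analysis"
begin

definition positive_vector :: "real ^ 'n \<Rightarrow> bool" where
  "positive_vector w \<longleftrightarrow> (\<forall>i. 0 < w $ i)"

definition pairwise_comparison_matrices :: "(real ^ 'n ^ 'n) set" where
  "pairwise_comparison_matrices =
    {A. (\<forall>i j. 0 < A $ i $ j) \<and> (\<forall>i. A $ i $ i = 1) \<and> (\<forall>i j. A $ i $ j = 1 / A $ j $ i)}"

definition compatible :: "real ^ 'n \<Rightarrow> real ^ 'n ^ 'n \<Rightarrow> bool" where
  "compatible w A \<longleftrightarrow> positive_vector w \<and> (\<forall>i j. A $ i $ j = w $ i / w $ j)"

definition consistent_matrices :: "(real ^ 'n ^ 'n) set" where
  "consistent_matrices = {A \<in> pairwise_comparison_matrices. \<exists>w. compatible w A}"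

definition diag :: "real ^ 'n \<Rightarrow> real ^ 'n ^ 'n" where
  "diag d = (\<chi> i j. if i = j then d $ i else 0)"

text \<open>
  \<open>columnvector\<close> and \<open>rowvector\<close> leave the other dimension polymorphic; it has to be fixed
  to \<open>1\<close> for the product below to be \<open>x y\<^sup>T\<close>.
\<close>

definition outer_product :: "real ^ 'n \<Rightarrow> real ^ 'n \<Rightarrow> real ^ 'n ^ 'n" where
  "outer_product x y = (columnvector x :: real ^ 1 ^ 'n) ** (rowvector y :: real ^ 'n ^ 1)"

definition doubly_stochastic :: "real ^ 'n ^ 'n \<Rightarrow> bool" where
  "doubly_stochastic S \<longleftrightarrow>
    (\<forall>i j. 0 \<le> S $ i $ j) \<and>
    (\<forall>i. (\<Sum>j\<in>UNIV. S $ i $ j) = 1) \<and>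
    (\<forall>j. (\<Sum>i\<in>UNIV. S $ i $ j) = 1)"

text \<open>
  The diagonal factors are determined only up to replacing \<open>(D1, D2)\<close> by \<open>(c D1, c\<^sup>-\<^sup>1 D2)\<close> with
  \<open>c > 0\<close>, so a Sinkhorn scaling is a relation between \<open>A\<close>, the diagonals \<open>d1\<close>, \<open>d2\<close> of the
  factors, and \<open>S\<close>, rather than a function of \<open>A\<close>.
\<close>

definition sinkhorn_scaling ::
  "real ^ 'n ^ 'n \<Rightarrow> real ^ 'n \<Rightarrow> real ^ 'n \<Rightarrow> real ^ 'n ^ 'n \<Rightarrow> bool" where
  "sinkhorn_scaling A d1 d2 S \<longleftrightarrow>
    positive_vector d1 \<and> positive_vector d2 \<and>
    S = diag d1 ** A ** diag d2 \<and> doubly_stochastic S"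

end

theory Submission
  imports Defs
begin

text \<open>The entries of \<open>S\<close> are \<open>d1 $ i * A $ i $ j * d2 $ j\<close>. If
  \<open>A\<close> is consistent, its entries are quotients \<open>w $ i / w $ j\<close>, so
  \<open>S\<close> has rank one, and the only doubly stochastic matrix of rank one is the uniform
  one (\<open>doubly_stochastic_rank_one\<close>). Conversely, if \<open>S\<close> is uniform, the
  unit diagonal of \<open>A\<close> makes every product \<open>d1 $ i * d2 $ i\<close> equal to 1/n;
  comparing this with the other entries lets either \<open>d1\<close> or \<open>d2\<close> be
  cancelled, which yields both compatible vectors. Each of them witnesses consistency, which closes
  the cycle.\<close>

lemma diag_matrix_diag_nth:
  "(diag d ** A ** diag e) $ i $ j = d $ i * A $ i $ j * e $ j"
  by (simp add: diag_def matrix_matrix_mult_def if_distrib [of "\<lambda>x. x * _"]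
      if_distrib [of "\<lambda>x. _ * x"] cong: if_cong)

lemma outer_product_nth: "outer_product x y $ i $ j = x $ i * y $ j"
  by (simp add: outer_product_def matrix_matrix_mult_def columnvector_def rowvector_def)

text \<open>The row sums make \<open>x\<close> constant and the column sums make \<open>y\<close>
  constant; the total of all entries, n, fixes the common value.\<close>

lemma doubly_stochastic_rank_one:
  fixes S :: "real ^ 'n ^ 'n"
  assumes "doubly_stochastic S" and S: "\<And>i j. S $ i $ j = x i * y j"
  shows "S $ i $ j = 1 / real CARD('n)"
proof -
  have row: "x i * sum y UNIV = 1" and col: "sum x UNIV * y j = 1" for i j
    using assms by (simp_all add: doubly_stochastic_def sum_distrib_left sum_distrib_right)
  have "real CARD('n) = (\<Sum>i\<in>UNIV. x i * sum y UNIV)"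
    by (simp add: row)
  also have "\<dots> = sum x UNIV * sum y UNIV"
    by (simp add: sum_distrib_right)
  \<comment> \<open>With n factored as the product of the two sums, regrouping leaves one row sum
    times one column sum, both 1.\<close>
  finally have "x i * y j * real CARD('n) = (x i * sum y UNIV) * (sum x UNIV * y j)"
    by simp
  then have "S $ i $ j * real CARD('n) = 1"
    by (simp add: S row col)
  then show ?thesis
    by (simp add: field_simps)
qed

theorem proposition1:
  fixes A S :: "real ^ 'n ^ 'n" and d1 d2 :: "real ^ 'n"
  assumes "A \<in> pairwise_comparison_matrices"
    and "sinkhorn_scaling A d1 d2 S"
  shows "(A \<in> consistent_matrices \<longleftrightarrow>
            S = (1 / real CARD('n)) *\<^sub>R outer_product 1 1)
       \<and> (S = (1 / real CARD('n)) *\<^sub>R outer_product 1 1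
            \<longleftrightarrow> compatible d2 A)
       \<and> (compatible d2 A \<longleftrightarrow> compatible (\<chi> i. inverse (d1 $ i)) A)"
proof -
  have pos: "d1 $ i > 0" "d2 $ i > 0"
    and S: "S $ i $ j = d1 $ i * A $ i $ j * d2 $ j" for i j
    using assms(2) by (auto simp: sinkhorn_scaling_def positive_vector_def diag_matrix_diag_nth)
  have ds: "doubly_stochastic S"
    using assms(2) unfolding sinkhorn_scaling_def by blast
  have uniform: "S = (1 / real CARD('n)) *\<^sub>R outer_product 1 1
      \<longleftrightarrow> (\<forall>i j. S $ i $ j = 1 / real CARD('n))"
    by (simp add: vec_eq_iff outer_product_nth)
  have 12: "S = (1 / real CARD('n)) *\<^sub>R outer_product 1 1" if "A \<in> consistent_matrices"
  proof -
    from that obtain w where "\<And>i j. A $ i $ j = w $ i / w $ j"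
      by (auto simp: consistent_matrices_def compatible_def)
    \<comment> \<open>The factors depending on \<open>i\<close> and on \<open>j\<close>
      separate.\<close>
    then have "S $ i $ j = (d1 $ i * w $ i) * (d2 $ j / w $ j)" for i j
      by (simp add: S)
    from doubly_stochastic_rank_one [OF ds this] show ?thesis
      by (simp add: uniform)
  qed
  have 234: "compatible d2 A \<and> compatible (\<chi> i. inverse (d1 $ i)) A"
    if "S = (1 / real CARD('n)) *\<^sub>R outer_product 1 1"
  proof -
    have eq: "d1 $ i * A $ i $ j * d2 $ j = 1 / real CARD('n)" for i j
      using that uniform S by metis
    \<comment> \<open>This is where \<open>A $ i $ i = 1\<close> enters.\<close>
    have diagonal: "d1 $ i * d2 $ i = 1 / real CARD('n)" for i
      using eq [of i i] assms(1) by (simp add: pairwise_comparison_matrices_def)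
    have "compatible d2 A"
      unfolding compatible_def positive_vector_def
    proof (intro conjI allI pos)
      fix i j
      \<comment> \<open>Comparison with the diagonal entry of row \<open>i\<close> lets
        \<open>d1 $ i\<close> cancel.\<close>
      have "d1 $ i * (A $ i $ j * d2 $ j) = d1 $ i * d2 $ i"
        using eq [of i j] diagonal [of i] by (simp add: mult.assoc)
      with pos [of i] pos [of j] show "A $ i $ j = d2 $ i / d2 $ j"
        by (simp add: field_simps)
    qed
    moreover have "A $ i $ j = inverse (d1 $ i) / inverse (d1 $ j)" for i j
    proof -
      \<comment> \<open>Here the diagonal entry of column \<open>j\<close> is used instead, so that
        \<open>d2 $ j\<close> cancels.\<close>
      have "(d1 $ i * A $ i $ j) * d2 $ j = d1 $ j * d2 $ j"
        using eq [of i j] diagonal [of j] by simp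
      with pos [of i] pos [of j] show ?thesis
        by (simp add: field_simps)
    qed
    then have "compatible (\<chi> i. inverse (d1 $ i)) A"
      using pos(1) by (simp only: compatible_def positive_vector_def vec_lambda_beta
          inverse_positive_iff_positive simp_thms)
    ultimately show ?thesis
      by blast
  qed
  have "A \<in> consistent_matrices" if "compatible w A" for w
    using that assms(1) by (auto simp: consistent_matrices_def)
  with 12 234 show ?thesis
    by blast
qed

end
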